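(* Let $(X,d_X)$ be a Hadamard space and $x_1,x_2,x_3,x_4\in X$. Write $d_{ij}=d_X(x_i,x_j)$ for every $i,j\in\{1,2,3,4\}$. Then $$d_{12}d_{34}+d_{23}d_{41}-d_{13}d_{24}\ \ge\ \frac{\big((d_{12}d_{23}+d_{34}d_{41})d_{13}-(d_{12}d_{41}+d_{23}d_{34})d_{24}\big)^2}{2(d_{12}d_{41}+d_{23}d_{34})(d_{12}d_{23}+d_{34}d_{41})}\ \ge\ 0.$$
   Context: A Hadamard space is a complete geodesic metric space $(X,d_X)$ such that for every $x,y,z\in X$ and every metric midpoint $w$ of $x,y$ (i.e. $d_X(x,w)=d_X(y,w)=d_X(x,y)/2$) one has $d_X(x,y)^2+4d_X(z,w)^2\le 2d_X(x,z)^2+2d_X(y,z)^2$. If the denominator of the fraction vanishes, the fraction is interpreted as $0$. *)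

theory Defs
  imports "HOL-Analysis.Analysis"
begin

text \<open>Spaces are given by a carrier set and a distance as in the library locale
  \<^locale>\<open>Metric_space\<close>; nothing is required of \<open>d\<close>, apart from nonnegativity and
  symmetry, outside the carrier.\<close>

definition (in Metric_space) geodesic :: "(real \<Rightarrow> 'a) \<Rightarrow> 'a \<Rightarrow> 'a \<Rightarrow> bool" where
  "geodesic \<gamma> x y \<longleftrightarrow>
     \<gamma> ` {0..d x y} \<subseteq> M \<and> \<gamma> 0 = x \<and> \<gamma> (d x y) = y \<and>
     (\<forall>s\<in>{0..d x y}. \<forall>t\<in>{0..d x y}. d (\<gamma> s) (\<gamma> t) = \<bar>s - t\<bar>)"

definition (in Metric_space) metric_midpoint :: "'a \<Rightarrow> 'a \<Rightarrow> 'a \<Rightarrow> bool" where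
  "metric_midpoint w x y \<longleftrightarrow> w \<in> M \<and> d x w = d x y / 2 \<and> d y w = d x y / 2"

locale Hadamard_space = Metric_space +
  assumes complete: "mcomplete"
    and geodesic_ex: "\<And>x y. \<lbrakk>x \<in> M; y \<in> M\<rbrakk> \<Longrightarrow> \<exists>\<gamma>. geodesic \<gamma> x y"
    and midpoint_ineq: "\<And>x y z w. \<lbrakk>x \<in> M; y \<in> M; z \<in> M; metric_midpoint w x y\<rbrakk> \<Longrightarrow>
      (d x y)\<^sup>2 + 4 * (d z w)\<^sup>2 \<le> 2 * (d x z)\<^sup>2 + 2 * (d y z)\<^sup>2"

end

theory Submission
  imports Defs
begin

text \<open>The midpoint inequality says that the squared distance to a point is at least as convex
  along a geodesic as in Euclidean space. Applied to both diagonals of the quadrilateral, with a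
  point at parameter \<open>s\<close> on the first and a point at parameter \<open>t\<close> on the second, it bounds the
  squared distance of these two points, a nonnegative number, by an explicit quadratic expression
  in the six distances (\<open>quadrilateral_ineq\<close>). In a convex cyclic quadrilateral in the plane the
  diagonals meet, and the ratios in which they cut each other depend on the side lengths only.
  For these values of \<open>s\<close> and \<open>t\<close>, the bound is the difference of the two sides of the
  refined Ptolemy inequality, times a factor that is positive unless the product of the side
  lengths is zero (\<open>ptolemy_refined_algebra\<close>). If that product is zero, two
  consecutive vertices coincide, and then both sides of the claim vanish.\<close>

text \<open>A midpoint convex function on an interval need not be convex, but boundedness from above is
  enough to bound it by its values at the ends. Each point of the interval is the midpoint of an
  end, where the function is at most zero, and another point of the interval. So the function is
  at most half of its supremum; thus the supremum is
  not positive.\<close>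

lemma midpoint_convex_nonpos:
  fixes h :: "real \<Rightarrow> real"
  assumes bdd: "\<And>u. u \<in> {0..1} \<Longrightarrow> h u \<le> B"
    and mid: "\<And>u v. u \<in> {0..1} \<Longrightarrow> v \<in> {0..1} \<Longrightarrow> h ((u + v) / 2) \<le> (h u + h v) / 2"
    and ends: "h 0 \<le> 0" "h 1 \<le> 0"
    and s: "s \<in> {0..1}"
  shows "h s \<le> 0"
proof -
  define S where "S = (SUP u\<in>{0..1}. h u)"
  have "bdd_above (h ` {0..1})"
    using bdd by (intro bdd_aboveI2)
  then have upper: "h u \<le> S" if "u \<in> {0..1}" for u
    unfolding S_def using that by (intro cSUP_upper)
  have half: "h u \<le> S / 2" if u: "u \<in> {0..1}" for u
  proof (cases "u \<le> 1 / 2")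
    case True
    then show ?thesis
      using mid[of 0 "2 * u"] upper[of "2 * u"] ends(1) u by simp
  next
    case False
    then show ?thesis
      using mid[of 1 "2 * u - 1"] upper[of "2 * u - 1"] ends(2) u by simp
  qed
  have "S \<le> S / 2"
    unfolding S_def by (rule cSUP_least) (use half in \<open>auto simp: S_def\<close>)
  then show ?thesis
    using half[OF s] by linarith
qed

context Hadamard_space
begin

text \<open>Along a geodesic the difference of the two sides is midpoint convex: this is the midpoint
  inequality, in which the squared distance cancels against the second difference of
  \<open>s * (1 - s)\<close>. The point \<open>w\<close>
  is the same for all \<open>z\<close>, so that it can be compared with several vertices at once.\<close>

lemma geodesic_point_ineq:
  assumes x: "x \<in> M" and y: "y \<in> M" and s: "s \<in> {0..1}"
  obtains w where "w \<in> M"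
    and "\<And>z. z \<in> M \<Longrightarrow>
      (d w z)\<^sup>2 \<le> (1 - s) * (d x z)\<^sup>2 + s * (d y z)\<^sup>2 - s * (1 - s) * (d x y)\<^sup>2"
proof -
  define L where "L = d x y"
  have L: "0 \<le> L" by (simp add: L_def)
  obtain \<gamma> where \<gamma>: "geodesic \<gamma> x y"
    using geodesic_ex[OF x y] by blast
  define g where "g u = \<gamma> (u * L)" for u
  have range: "u * L \<in> {0..L}" if "u \<in> {0..1}" for u
    using that L by (auto intro: mult_left_le_one_le)
  have gM: "g u \<in> M" if "u \<in> {0..1}" for u
    using \<gamma> range[OF that] unfolding geodesic_def g_def L_def by blast
  have g0: "g 0 = x" and g1: "g 1 = y"
    using \<gamma> unfolding geodesic_def g_def L_def by simp_all
  have dist: "d (g u) (g v) = \<bar>u - v\<bar> * L" if u: "u \<in> {0..1}" and v: "v \<in> {0..1}" for u v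
  proof -
    have "d (g u) (g v) = \<bar>u * L - v * L\<bar>"
      using \<gamma> range[OF u] range[OF v] unfolding geodesic_def g_def L_def by blast
    also have "\<dots> = \<bar>u - v\<bar> * L"
      using L by (simp add: abs_mult flip: left_diff_distrib)
    finally show ?thesis .
  qed
  have main: "(d (g s) z)\<^sup>2 \<le> (1 - s) * (d x z)\<^sup>2 + s * (d y z)\<^sup>2 - s * (1 - s) * (d x y)\<^sup>2"
    if z: "z \<in> M" for z
  proof -
    define h where
      "h u = (d (g u) z)\<^sup>2 - (1 - u) * (d x z)\<^sup>2 - u * (d y z)\<^sup>2 + u * (1 - u) * L\<^sup>2" for u
    have "h s \<le> 0"
    proof (rule midpoint_convex_nonpos[where h = h and s = s and B = "(L + d x z)\<^sup>2 + L\<^sup>2"])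
      fix u :: real assume u: "u \<in> {0..1}"
      have "d (g u) z \<le> d (g u) (g 0) + d x z"
        using triangle[OF gM[OF u] x z] g0 by simp
      also have "d (g u) (g 0) \<le> L"
        using dist[OF u, of 0] u range[OF u] by simp
      finally have "(d (g u) z)\<^sup>2 \<le> (L + d x z)\<^sup>2"
        by (intro power_mono) auto
      moreover have "u * (1 - u) * L\<^sup>2 \<le> L\<^sup>2"
        using u by (intro mult_left_le_one_le) (auto intro: mult_le_one)
      moreover have "0 \<le> (1 - u) * (d x z)\<^sup>2" "0 \<le> u * (d y z)\<^sup>2"
        using u by auto
      ultimately show "h u \<le> (L + d x z)\<^sup>2 + L\<^sup>2"
        unfolding h_def by linarith
    next
      fix u v :: real assume u: "u \<in> {0..1}" and v: "v \<in> {0..1}"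
      define m where "m = (u + v) / 2"
      have m: "m \<in> {0..1}" using u v by (auto simp: m_def)
      have "\<bar>u - m\<bar> = \<bar>u - v\<bar> / 2" "\<bar>v - m\<bar> = \<bar>u - v\<bar> / 2"
        by (simp_all add: m_def field_simps abs_if)
      then have "metric_midpoint (g m) (g u) (g v)"
        unfolding metric_midpoint_def dist[OF u m] dist[OF v m] dist[OF u v]
        using gM[OF m] by simp
      from midpoint_ineq[OF gM[OF u] gM[OF v] z this]
      have "(\<bar>u - v\<bar> * L)\<^sup>2 + 4 * (d (g m) z)\<^sup>2 \<le> 2 * (d (g u) z)\<^sup>2 + 2 * (d (g v) z)\<^sup>2"
        unfolding dist[OF u v] by (simp add: commute)
      then have "4 * (d (g m) z)\<^sup>2 \<le> 2 * (d (g u) z)\<^sup>2 + 2 * (d (g v) z)\<^sup>2 - (u - v)\<^sup>2 * L\<^sup>2"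
        by (simp add: power_mult_distrib)
      moreover have "4 * (m * (1 - m)) = 2 * (u * (1 - u)) + 2 * (v * (1 - v)) + (u - v)\<^sup>2"
        by (simp add: m_def power2_eq_square field_simps)
      then have "4 * (m * (1 - m) * L\<^sup>2)
          = 2 * (u * (1 - u) * L\<^sup>2) + 2 * (v * (1 - v) * L\<^sup>2) + (u - v)\<^sup>2 * L\<^sup>2"
        by algebra
      moreover have "2 * ((1 - m) * (d x z)\<^sup>2) = (1 - u) * (d x z)\<^sup>2 + (1 - v) * (d x z)\<^sup>2"
        "2 * (m * (d y z)\<^sup>2) = u * (d y z)\<^sup>2 + v * (d y z)\<^sup>2"
        by (simp_all add: m_def algebra_simps)
      ultimately have "h m \<le> (h u + h v) / 2"
        unfolding h_def by argo
      then show "h ((u + v) / 2) \<le> (h u + h v) / 2"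
        unfolding m_def .
    qed (use s in \<open>auto simp: h_def g0 g1\<close>)
    then show ?thesis
      unfolding h_def L_def by linarith
  qed
  show ?thesis
    using that[OF gM[OF s] main] .
qed

text \<open>The right-hand side bounds the squared distance of a point on the diagonal from \<open>x1\<close> to \<open>x3\<close>
  and a point on the diagonal from \<open>x2\<close> to \<open>x4\<close>.\<close>

lemma quadrilateral_ineq:
  assumes "x1 \<in> M" "x2 \<in> M" "x3 \<in> M" "x4 \<in> M"
    and s: "s \<in> {0..1}" and t: "t \<in> {0..1}"
  shows "0 \<le> (1 - s) * (1 - t) * (d x1 x2)\<^sup>2 + s * (1 - t) * (d x2 x3)\<^sup>2
      + s * t * (d x3 x4)\<^sup>2 + (1 - s) * t * (d x4 x1)\<^sup>2
      - s * (1 - s) * (d x1 x3)\<^sup>2 - t * (1 - t) * (d x2 x4)\<^sup>2"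
proof -
  obtain w where w: "w \<in> M" and wz: "\<And>z. z \<in> M \<Longrightarrow>
      (d w z)\<^sup>2 \<le> (1 - s) * (d x1 z)\<^sup>2 + s * (d x3 z)\<^sup>2 - s * (1 - s) * (d x1 x3)\<^sup>2"
    using geodesic_point_ineq[OF assms(1,3) s] by metis
  obtain v where vz: "\<And>z. z \<in> M \<Longrightarrow>
      (d v z)\<^sup>2 \<le> (1 - t) * (d x2 z)\<^sup>2 + t * (d x4 z)\<^sup>2 - t * (1 - t) * (d x2 x4)\<^sup>2"
    using geodesic_point_ineq[OF assms(2,4) t] by metis
  have "0 \<le> (d v w)\<^sup>2" by simp
  also have "\<dots> \<le> (1 - t) * (d w x2)\<^sup>2 + t * (d w x4)\<^sup>2 - t * (1 - t) * (d x2 x4)\<^sup>2"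
    using vz[OF w] by (simp add: commute)
  also have "\<dots> \<le> (1 - t) * ((1 - s) * (d x1 x2)\<^sup>2 + s * (d x3 x2)\<^sup>2 - s * (1 - s) * (d x1 x3)\<^sup>2)
      + t * ((1 - s) * (d x1 x4)\<^sup>2 + s * (d x3 x4)\<^sup>2 - s * (1 - s) * (d x1 x3)\<^sup>2)
      - t * (1 - t) * (d x2 x4)\<^sup>2"
    using t wz[OF assms(2)] wz[OF assms(4)]
    by (intro diff_right_mono add_mono mult_left_mono) auto
  also have "\<dots> = (1 - s) * (1 - t) * (d x1 x2)\<^sup>2 + s * (1 - t) * (d x2 x3)\<^sup>2
      + s * t * (d x3 x4)\<^sup>2 + (1 - s) * t * (d x4 x1)\<^sup>2
      - s * (1 - s) * (d x1 x3)\<^sup>2 - t * (1 - t) * (d x2 x4)\<^sup>2"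
    unfolding commute[of x3 x2] commute[of x1 x4] by algebra
  finally show ?thesis .
qed

end

text \<open>Here \<open>a\<close>, \<open>b\<close>, \<open>c\<close>, \<open>e\<close> are consecutive sides and \<open>p\<close>, \<open>q\<close> the diagonals. If the vertices
  lie on a circle, the diagonals cut each other in the ratios \<open>a * e : b * c\<close> and \<open>a * b : c * e\<close>;
  this is where the parameters come from. With them, the four side terms combine to
  \<open>2 * a * b * c * e * (a * c + b * e)\<close> over a common denominator, so that the factor
  \<open>a * b * c * e\<close> cancels.\<close>

lemma ptolemy_refined_algebra:
  fixes a b c e p q :: real
  defines "D \<equiv> a * e + b * c" and "E \<equiv> a * b + c * e"
  defines "s \<equiv> a * e / D" and "t \<equiv> a * b / E"
  assumes pos: "0 < a" "0 < b" "0 < c" "0 < e"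
    and ineq: "0 \<le> (1 - s) * (1 - t) * a\<^sup>2 + s * (1 - t) * b\<^sup>2 + s * t * c\<^sup>2 + (1 - s) * t * e\<^sup>2
      - s * (1 - s) * p\<^sup>2 - t * (1 - t) * q\<^sup>2"
  shows "(E * p - D * q)\<^sup>2 / (2 * D * E) \<le> a * c + b * e - p * q"
proof -
  have D: "0 < D" and E: "0 < E"
    using pos by (simp_all add: D_def E_def add_pos_pos)
  have s1: "1 - s = b * c / D" and t1: "1 - t = c * e / E"
    using D E by (simp_all add: s_def t_def field_simps) (simp_all add: D_def E_def)
  define K where "K = a * b * c * e"
  have K: "0 < K" using pos by (simp add: K_def)
  have "(1 - s) * (1 - t) * a\<^sup>2 + s * (1 - t) * b\<^sup>2 + s * t * c\<^sup>2 + (1 - s) * t * e\<^sup>2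
      - s * (1 - s) * p\<^sup>2 - t * (1 - t) * q\<^sup>2
      = K * (2 * (a * c + b * e) / (D * E) - p\<^sup>2 / D\<^sup>2 - q\<^sup>2 / E\<^sup>2)"
    unfolding s1 t1 unfolding s_def t_def K_def using D E
    by (simp add: divide_simps power2_eq_square) (simp add: algebra_simps)
  then have "0 \<le> 2 * (a * c + b * e) / (D * E) - p\<^sup>2 / D\<^sup>2 - q\<^sup>2 / E\<^sup>2"
    using ineq K by (simp add: zero_le_mult_iff)
  then have "0 \<le> D * E / 2 * (2 * (a * c + b * e) / (D * E) - p\<^sup>2 / D\<^sup>2 - q\<^sup>2 / E\<^sup>2)"
    using D E by (intro mult_nonneg_nonneg) auto
  also have "\<dots> = (a * c + b * e - p * q) - (E * p - D * q)\<^sup>2 / (2 * D * E)"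
    using D E by (simp add: field_simps power2_eq_square)
  finally show ?thesis by simp
qed

theorem corollary30:
  fixes X :: "'a set" and dX :: "'a \<Rightarrow> 'a \<Rightarrow> real" and x1 x2 x3 x4 :: 'a
  assumes "Hadamard_space X dX"
    and "x1 \<in> X" "x2 \<in> X" "x3 \<in> X" "x4 \<in> X"
  shows "let d12 = dX x1 x2; d13 = dX x1 x3; d23 = dX x2 x3;
             d24 = dX x2 x4; d34 = dX x3 x4; d41 = dX x4 x1;
             F = ((d12 * d23 + d34 * d41) * d13 - (d12 * d41 + d23 * d34) * d24)\<^sup>2
                 / (2 * (d12 * d41 + d23 * d34) * (d12 * d23 + d34 * d41))
         in d12 * d34 + d23 * d41 - d13 * d24 \<ge> F \<and> F \<ge> 0"
proof -
  interpret Hadamard_space X dX by fact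
  define a b c e p q where "a = dX x1 x2" and "b = dX x2 x3" and "c = dX x3 x4"
    and "e = dX x4 x1" and "p = dX x1 x3" and "q = dX x2 x4"
  note defs = a_def b_def c_def e_def p_def q_def
  have nonneg: "0 \<le> a" "0 \<le> b" "0 \<le> c" "0 \<le> e"
    by (simp_all add: defs)
  let ?D = "a * e + b * c" and ?E = "a * b + c * e"
  have F_nonneg: "0 \<le> (?E * p - ?D * q)\<^sup>2 / (2 * ?D * ?E)"
    using nonneg by simp
  have F_le: "(?E * p - ?D * q)\<^sup>2 / (2 * ?D * ?E) \<le> a * c + b * e - p * q"
  proof (cases "a = 0 \<or> b = 0 \<or> c = 0 \<or> e = 0")
    case True
    then have "x1 = x2 \<or> x2 = x3 \<or> x3 = x4 \<or> x4 = x1"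
      using assms(2-5) by (simp add: defs)
    then have "?E * p - ?D * q = 0 \<and> a * c + b * e - p * q = 0"
      using assms(2-5) by (elim disjE) (simp_all add: defs commute)
    then show ?thesis by simp
  next
    case False
    then have pos: "0 < a" "0 < b" "0 < c" "0 < e"
      using nonneg by auto
    have "a * e / ?D \<in> {0..1}" "a * b / ?E \<in> {0..1}"
      using pos by (simp_all add: add_pos_pos)
    from quadrilateral_ineq[OF assms(2-5) this]
    show ?thesis
      unfolding defs[symmetric] by (rule ptolemy_refined_algebra[OF pos])
  qed
  show ?thesis
    using F_nonneg F_le unfolding Let_def defs by simp
qed

end
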